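(* There exists a sequence $(A_p)_{p\ge 1}$ of rational numbers such that $\xi(2p) = A_p\,\pi^{2p}$ for every integer $p\ge 1$. The terms of this sequence are determined by $A_1 = \frac{1}{12}$ and by the recurrence relation $$\forall p\ge 2,\quad A_p = \frac{(-1)^{p-1}}{(2p)!}\left(\frac{1}{2(2p+1)} - \sum_{k=1}^{p-1}(-1)^{k-1}\frac{(2p)!}{(2p+1-2k)!}A_k\right).$$
   Context: For real $x>0$, $\xi(x)=\sum_{n=1}^{+\infty}\frac{(-1)^{n-1}}{n^x}$. *)

theory Defs
  imports Complex_Main
begin

(* The summation index is shifted by one, so the n-th term here is (-1)^((n+1)-1) / (n+1)^x.
   For 0 < x \<le> 1 the series converges only conditionally; suminf is the limit of the
   partial sums in increasing order of n. *)
definition xi :: "real \<Rightarrow> real" where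
  "xi x = (\<Sum>n. (-1) ^ n / real (n + 1) powr x)"

lemma xi_sums:
  assumes "x > 0"
  shows "(\<lambda>n. (-1) ^ n / real (n + 1) powr x) sums xi x"
proof -
  have "filterlim (\<lambda>n. real (n + 1)) at_top sequentially"
    by (rule filterlim_compose[OF filterlim_real_sequentially])
       (rule filterlim_add_const_nat_at_top)
  then have lim: "(\<lambda>n. real (n + 1) powr (- x)) \<longlonglongrightarrow> 0"
    using assms by (intro tendsto_neg_powr) auto
  have "monoseq (\<lambda>n. real (n + 1) powr (- x))"
    using assms by (intro decseq_imp_monoseq) (auto simp: decseq_def intro!: powr_mono2')
  from summable_Leibniz(1)[OF lim this]
  have "summable (\<lambda>n. (-1) ^ n * real (n + 1) powr (- x))" .
  then have "summable (\<lambda>n. (-1) ^ n / real (n + 1) powr x)"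
    by (simp add: powr_minus divide_inverse)
  then show ?thesis
    unfolding xi_def by (rule summable_sums)
qed

definition xi_recurrence :: "(nat \<Rightarrow> rat) \<Rightarrow> bool" where
  "xi_recurrence A \<longleftrightarrow>
     A 1 = 1 / 12 \<and>
     (\<forall>p\<ge>2. A p = (-1) ^ (p - 1) / fact (2 * p) *
        (1 / (2 * (2 * of_nat p + 1)) -
         (\<Sum>k = 1..p - 1. (-1) ^ (k - 1) * (fact (2 * p) / fact (2 * p + 1 - 2 * k)) * A k)))"

end

theory Submission
  imports Defs "HOL-Analysis.Analysis"
begin

(* The reflection formula of the Gamma function yields the partial fraction series of the
   cotangent. Evaluating it at x and x/2 gives that of pi / sin (pi x), and expanding the latter
   in geometric series shows that 1 + 2 * (\<Sum>p\<ge>1. xi(2p) x^(2p)) is the inverse of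
   sin (pi x) / (pi x). The recurrence compares coefficients in the product of these two
   power series in x^2. *)

section \<open>Partial fractions of cotangent and cosecant\<close>

text \<open>This is the logarithmic derivative of the reflection formula, kept free of division:
  \<open>Gamma t * Gamma (1 - t) * sin (pi * t)\<close> is constant on the open unit interval, so
  its derivative at \<open>x\<close> vanishes, and the nonzero Gamma factors cancel.\<close>

lemma Digamma_reflection_real:
  fixes x :: real
  assumes x: "0 < x" "x < 1"
  shows "Digamma (1 - x) - Digamma x = pi * cot (pi * x)"
proof -
  let ?g = "\<lambda>t::real. Gamma t * Gamma (1 - t) * sin (pi * t)"
  have sin_pos: "sin (pi * t) > 0" if "t \<in> {0<..<1}" for t
    using that by (intro sin_gt_zero) auto
  have const: "?g t = pi" if t: "t \<in> {0<..<1}" for t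
  proof -
    have "complex_of_real (Gamma t * Gamma (1 - t)) = Gamma (of_real t) * Gamma (1 - of_real t)"
      by (simp only: of_real_mult of_real_diff of_real_1 Gamma_complex_of_real[symmetric])
    also have "\<dots> = of_real (pi / sin (pi * t))"
      by (simp only: Gamma_reflection_complex of_real_divide of_real_mult sin_of_real[symmetric])
    finally have "complex_of_real (Gamma t * Gamma (1 - t)) = of_real (pi / sin (pi * t))" .
    then have "Gamma t * Gamma (1 - t) = pi / sin (pi * t)"
      by (simp only: of_real_eq_iff)
    with sin_pos[OF t] show ?thesis
      by (simp add: field_simps)
  qed
  have nonpos: "x \<notin> \<int>\<^sub>\<le>\<^sub>0" "1 - x \<notin> \<int>\<^sub>\<le>\<^sub>0"
    using x by (auto elim!: nonpos_Ints_cases)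
  have "(?g has_field_derivative
      Gamma x * Gamma (1 - x) *
        ((Digamma x - Digamma (1 - x)) * sin (pi * x) + pi * cos (pi * x))) (at x)"
    using nonpos by (auto intro!: derivative_eq_intros simp: algebra_simps)
  moreover have "(?g has_field_derivative 0) (at x)"
    by (rule has_field_derivative_transform_within_open[OF DERIV_const[of pi], of "{0<..<1}"])
       (use x const in auto)
  ultimately have "Gamma x * Gamma (1 - x) *
        ((Digamma x - Digamma (1 - x)) * sin (pi * x) + pi * cos (pi * x)) = 0"
    by (rule DERIV_unique)
  moreover have "Gamma x \<noteq> 0" "Gamma (1 - x) \<noteq> 0"
    using x by (simp_all add: Gamma_real_pos less_imp_neq[symmetric])
  ultimately have "(Digamma x - Digamma (1 - x)) * sin (pi * x) + pi * cos (pi * x) = 0"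
    by simp
  with sin_pos[of x] x show ?thesis
    by (simp add: cot_def field_simps)
qed

text \<open>In the difference of the Digamma series at \<open>1 + x\<close> and
  \<open>1 - x\<close>, the harmonic terms and the Euler-Mascheroni constant cancel. The summand
  \<open>1 / x\<close> comes from shifting \<open>Digamma (1 + x)\<close> back to
  \<open>Digamma x\<close> before reflecting.\<close>

lemma cot_partial_fractions:
  fixes x :: real
  assumes x: "0 < x" "x < 1"
  shows "(\<lambda>n. 2 * x / (real (n + 1) ^ 2 - x ^ 2)) sums (1 / x - pi * cot (pi * x))"
proof -
  have "(\<lambda>n. inverse (real (Suc n)) - inverse (z + real n)) sums (Digamma z + euler_mascheroni)"
    if "z \<noteq> 0" for z :: real
    using summable_sums[OF summable_Digamma[OF that]] by (simp add: Digamma_def)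
  from sums_diff[OF this[of "1 + x"] this[of "1 - x"]]
  have "(\<lambda>n. inverse (1 - x + real n) - inverse (1 + x + real n)) sums
          (Digamma (1 + x) - Digamma (1 - x))"
    using x by simp
  also have "Digamma (1 + x) - Digamma (1 - x) = 1 / x - pi * cot (pi * x)"
    using Digamma_reflection_real[OF x] Digamma_plus1[of x] x by (simp add: add.commute)
  also have "(\<lambda>n. inverse (1 - x + real n) - inverse (1 + x + real n)) =
               (\<lambda>n. 2 * x / (real (n + 1) ^ 2 - x ^ 2))"
  proof
    fix n
    have "real n + 1 - x \<noteq> 0" "real n + 1 + x \<noteq> 0"
      using x by linarith+
    moreover have "real (n + 1) ^ 2 - x ^ 2 = (real n + 1 - x) * (real n + 1 + x)"
      by (simp add: power2_eq_square algebra_simps)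
    ultimately show "inverse (1 - x + real n) - inverse (1 + x + real n) =
                       2 * x / (real (n + 1) ^ 2 - x ^ 2)"
      by (simp only:) (simp add: field_simps)
  qed
  finally show ?thesis .
qed

lemma cot_half_diff_cot:
  fixes x :: real
  assumes "sin x \<noteq> 0"
  shows "cot (x / 2) - cot x = 1 / sin x"
proof -
  define s c where "s = sin (x / 2)" and "c = cos (x / 2)"
  have sin: "sin x = 2 * s * c" and cos: "cos x = 2 * c\<^sup>2 - 1"
    using sin_double[of "x / 2"] cos_double_cos[of "x / 2"] by (simp_all add: s_def c_def)
  then have "s \<noteq> 0" "c \<noteq> 0"
    using assms by auto
  then show ?thesis
    unfolding cot_def sin cos s_def[symmetric] c_def[symmetric]
    by (simp add: field_simps power2_eq_square)
qed

text \<open>The identity \<open>cot (y / 2) - cot y = 1 / sin y\<close> turns the cotangent series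
  at \<open>x / 2\<close> minus the one at \<open>x\<close> into a series for the cosecant. The
  former supplies twice the terms of odd index \<open>n\<close> of the latter, so the subtraction
  flips exactly their signs.\<close>

lemma inverse_sin_partial_fractions:
  fixes x :: real
  assumes x: "0 < x" "x < 1"
  shows "(\<lambda>n. (-1) ^ n * (2 * x / (real (n + 1) ^ 2 - x ^ 2))) sums (pi / sin (pi * x) - 1 / x)"
proof -
  let ?f = "\<lambda>x n. 2 * x / (real (n + 1) ^ 2 - x ^ 2)"
  \<comment> \<open>The series at \<open>x / 2\<close> is spread over the odd indices, with zeros in
    between, so that the two series can be subtracted term by term.\<close>
  have "(\<lambda>n. if even n then 0 else ?f (x / 2) ((n - 1) div 2)) sums
          (1 / (x / 2) - pi * cot (pi * (x / 2)))"
    by (intro sums_if' cot_partial_fractions) (use x in auto)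
  from sums_diff[OF cot_partial_fractions[OF x] this]
  have "(\<lambda>n. ?f x n - (if even n then 0 else ?f (x / 2) ((n - 1) div 2))) sums
          (pi * (cot (pi * x / 2) - cot (pi * x)) - 1 / x)"
    by (simp add: algebra_simps)
  also have "(\<lambda>n. ?f x n - (if even n then 0 else ?f (x / 2) ((n - 1) div 2))) =
               (\<lambda>n. (-1) ^ n * ?f x n)"
  proof
    fix n
    show "?f x n - (if even n then 0 else ?f (x / 2) ((n - 1) div 2)) = (-1) ^ n * ?f x n"
    proof (cases "even n")
      case False
      then obtain k where k: "n = 2 * k + 1"
        by (elim oddE)
      define d where "d = real (k + 1) ^ 2 - (x / 2) ^ 2"
      have "real (n + 1) ^ 2 - x ^ 2 = 4 * d"
        by (simp add: d_def k power2_eq_square field_simps)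
      then have "?f (x / 2) k = 2 * ?f x n"
        unfolding d_def[symmetric] by simp
      with k show ?thesis
        by simp
    qed simp
  qed
  also have "cot (pi * x / 2) - cot (pi * x) = 1 / sin (pi * x)"
    using x sin_gt_zero[of "pi * x"] by (intro cot_half_diff_cot) auto
  finally show ?thesis
    by simp
qed

section \<open>Generating function of the values at even integers\<close>

text \<open>Summability of the row sums \<open>b\<close> of absolute values makes the double family
  unconditionally summable, so Fubini for \<open>has_sum\<close> applies. The hypotheses and the
  conclusion stay in terms of \<open>sums\<close>, which is how the series at hand are
  given.\<close>

lemma sums_swap:
  fixes a :: "nat \<Rightarrow> nat \<Rightarrow> real"
  assumes abs: "\<And>n. (\<lambda>p. \<bar>a n p\<bar>) sums b n" and "summable b"
    and row: "\<And>n. (\<lambda>p. a n p) sums r n" and r: "r sums S"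
    and col: "\<And>p. (\<lambda>n. a n p) sums c p"
  shows "c sums S"
proof -
  have b_nonneg: "b n \<ge> 0" for n
    by (rule sums_le[OF _ sums_zero abs]) auto
  have "(\<lambda>(n, p). \<bar>a n p\<bar>) summable_on UNIV \<times> UNIV"
    by (rule summable_on_SigmaI[where g = b])
       (use abs \<open>summable b\<close> b_nonneg in
         \<open>auto intro!: sums_nonneg_imp_has_sum summable_nonneg_imp_summable_on\<close>)
  then have "(\<lambda>z. norm (case z of (n, p) \<Rightarrow> a n p)) summable_on UNIV \<times> UNIV"
    by (simp add: case_prod_unfold)
  then have sm: "(\<lambda>(n, p). a n p) summable_on UNIV \<times> UNIV"
    by (rule abs_summable_summable)
  have row': "((\<lambda>p. a n p) has_sum r n) UNIV" for n
    by (rule norm_summable_imp_has_sum) (use abs row in \<open>auto simp: sums_iff\<close>)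
  \<comment> \<open>Domination by \<open>b\<close> gives absolute convergence of \<open>r\<close>,
    which upgrades the ordered sum \<open>S\<close> to an unordered one.\<close>
  have "\<bar>r n\<bar> \<le> b n" for n
  proof -
    have "r n \<le> b n" by (rule sums_le[OF _ row abs]) auto
    moreover have "- r n \<le> b n" by (rule sums_le[OF _ sums_minus[OF row] abs]) auto
    ultimately show ?thesis by linarith
  qed
  then have "summable (\<lambda>n. norm (r n))"
    by (intro summable_comparison_test[OF _ \<open>summable b\<close>]) auto
  then have "(r has_sum S) UNIV"
    using r by (rule norm_summable_imp_has_sum)
  then have total: "((\<lambda>(n, p). a n p) has_sum S) (UNIV \<times> UNIV)"
    using sm row' by (intro has_sum_SigmaI[where g = r]) auto
  then have total': "((\<lambda>(p, n). a n p) has_sum S) (UNIV \<times> UNIV)"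
    by (subst (asm) has_sum_swap) simp
  \<comment> \<open>Each column inherits unordered summability from the whole family; uniqueness of
    limits then identifies its sum with \<open>c p\<close>.\<close>
  have "(\<lambda>n. a n p) summable_on UNIV" for p
    using summable_on_SigmaD1[of "\<lambda>p n. a n p" UNIV "\<lambda>_. UNIV" p] total'
    by (auto simp: summable_on_def)
  then have "((\<lambda>n. a n p) has_sum c p) UNIV" for p
    using col[of p] has_sum_imp_sums sums_unique2 by (metis summable_iff_has_sum_infsum)
  then have "(c has_sum S) UNIV"
    by (intro has_sum_SigmaD[OF total']) auto
  then show ?thesis
    by (rule has_sum_imp_sums)
qed

lemma xi_even_sums:
  assumes "p \<ge> 1"
  shows "(\<lambda>n. (-1) ^ n / real (n + 1) ^ (2 * p)) sums xi (2 * real p)"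
proof -
  have "real (n + 1) powr (2 * real p) = real (n + 1) ^ (2 * p)" for n
    using powr_realpow[of "real (n + 1)" "2 * p"] by simp
  then show ?thesis
    using xi_sums[of "2 * real p"] assms by simp
qed

text \<open>Multiplied by \<open>x\<close>, each cosecant term is a geometric series in
  \<open>x ^ 2 / real (n + 1) ^ 2\<close>. Summing over \<open>n\<close> first instead of
  \<open>p\<close> collects the series for \<open>xi\<close> at even integers.\<close>

lemma xi_even_generating_function:
  fixes x :: real
  assumes x: "0 < x" "x < 1"
  shows "(\<lambda>p. 2 * xi (2 * real (Suc p)) * x ^ (2 * Suc p)) sums (pi * x / sin (pi * x) - 1)"
proof (rule sums_swap)
  let ?q = "\<lambda>n. x ^ 2 / real (n + 1) ^ 2"
  let ?b = "\<lambda>n. x * (2 * x / (real (n + 1) ^ 2 - x ^ 2))"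
  have abs: "(\<lambda>p. 2 * ?q n ^ Suc p) sums ?b n" for n
  proof -
    define N where "N = real (n + 1) ^ 2"
    have "x ^ 2 < N"
      unfolding N_def using x by (intro power_strict_mono) auto
    moreover have "N > 0"
      by (simp add: N_def)
    ultimately have "norm (?q n) < 1" and *: "2 * ?q n * (1 / (1 - ?q n)) = ?b n"
      unfolding N_def[symmetric] by (simp_all add: divide_simps power2_eq_square)
    from sums_mult[OF geometric_sums[OF this(1)], of "2 * ?q n"] show ?thesis
      unfolding * by (simp add: mult_ac)
  qed
  show "(\<lambda>p. \<bar>(-1) ^ n * (2 * ?q n ^ Suc p)\<bar>) sums ?b n" for n
    using abs[of n] by (simp add: abs_mult power_abs)
  show "(\<lambda>p. (-1) ^ n * (2 * ?q n ^ Suc p)) sums ((-1) ^ n * ?b n)" for n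
    by (intro sums_mult abs)
  \<comment> \<open>Dropping the signs turns the cosecant series into the cotangent series, whose
    convergence is the required domination.\<close>
  show "summable ?b"
    using cot_partial_fractions[OF x] by (intro summable_mult) (rule sums_summable)
  show "(\<lambda>n. (-1) ^ n * ?b n) sums (pi * x / sin (pi * x) - 1)"
    using sums_mult[OF inverse_sin_partial_fractions[OF x], of x] x
    by (simp add: right_diff_distrib mult_ac)
  show "(\<lambda>n. (-1) ^ n * (2 * ?q n ^ Suc p)) sums (2 * xi (2 * real (Suc p)) * x ^ (2 * Suc p))" for p
  proof -
    have "(-1) ^ n * (2 * ?q n ^ Suc p) =
            2 * x ^ (2 * Suc p) * ((-1) ^ n / real (n + 1) ^ (2 * Suc p))" for n
      by (simp add: power_divide del: power_Suc flip: power_mult)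
    then show ?thesis
      using sums_mult[OF xi_even_sums[of "Suc p"], of "2 * x ^ (2 * Suc p)"]
      by (simp add: mult_ac)
  qed
qed

section \<open>The product of the two power series\<close>

text \<open>A one-sided identity theorem: after division by the lowest power, the series is
  continuous at 0 with the leading coefficient as its value, yet it vanishes to the right of 0. One
  side suffices here because the variable will be a square.\<close>

lemma fps_eq_0_if_eval_eq_0_at_right:
  fixes f :: "real fps"
  assumes rad: "fps_conv_radius f > 0"
    and zero: "eventually (\<lambda>x. eval_fps f x = 0) (at_right 0)"
  shows "f = 0"
proof (rule ccontr)
  assume "f \<noteq> 0"
  let ?g = "fps_shift (subdegree f) f"
  obtain r :: real where r: "r > 0" "ereal r < fps_conv_radius f"
    using ereal_dense2[OF rad] by (auto simp: zero_ereal_def)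
  have "isCont (eval_fps ?g) 0"
    using rad by (intro continuous_eval_fps) (auto simp: zero_ereal_def)
  then have "(eval_fps ?g \<longlongrightarrow> fps_nth f (subdegree f)) (at_right 0)"
    by (simp add: isCont_def eval_fps_at_0 filterlim_at_split)
  moreover have "eventually (\<lambda>x. eval_fps ?g x = 0) (at_right 0)"
    using zero eventually_at_right_real[OF r(1)]
  proof eventually_elim
    case (elim x)
    with r have "ereal (norm x) < fps_conv_radius f"
      by (intro less_trans[OF _ r(2)]) auto
    with elim show ?case
      by (subst eval_fps_shift) auto
  qed
  then have "(eval_fps ?g \<longlongrightarrow> 0) (at_right 0)"
    by (rule tendsto_eventually)
  ultimately have "fps_nth f (subdegree f) = 0"
    by (intro tendsto_unique[OF trivial_limit_at_right_real])
  with \<open>f \<noteq> 0\<close> show False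
    by simp
qed

text \<open>The expansion of \<open>pi * x / sin (pi * x)\<close> in the variable
  \<open>x ^ 2\<close>. The constant term is set separately, since the series behind
  \<open>xi 0\<close> diverges.\<close>

definition xi_fps :: "real fps" where
  "xi_fps = Abs_fps (\<lambda>p. if p = 0 then 1 else 2 * xi (2 * real p))"

text \<open>The expansion of \<open>sin (pi * x) / (pi * x)\<close>, again in the variable
  \<open>x ^ 2\<close>.\<close>

definition sinc_fps :: "real fps" where
  "sinc_fps = Abs_fps (\<lambda>p. (-1) ^ p * pi ^ (2 * p) / fact (2 * p + 1))"

lemma xi_fps_sums:
  assumes "0 < x" "x < 1"
  shows "(\<lambda>p. fps_nth xi_fps p * (x ^ 2) ^ p) sums (pi * x / sin (pi * x))"
proof -
  have "(\<lambda>p. fps_nth xi_fps (Suc p) * (x ^ 2) ^ Suc p) sums (pi * x / sin (pi * x) - 1)"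
    using xi_even_generating_function[OF assms] by (simp add: xi_fps_def del: power_Suc flip: power_mult)
  from sums_Suc[OF this] show ?thesis
    by (simp add: xi_fps_def)
qed

lemma sinc_fps_sums:
  assumes "x \<noteq> 0"
  shows "(\<lambda>p. fps_nth sinc_fps p * (x ^ 2) ^ p) sums (sin (pi * x) / (pi * x))"
proof -
  have "(-1) ^ p / fact (2 * p + 1) * (pi * x) ^ (2 * p + 1) / (pi * x) =
          fps_nth sinc_fps p * (x ^ 2) ^ p" for p
    using assms by (simp add: sinc_fps_def power_mult_distrib flip: power_mult)
  then show ?thesis
    using sums_divide[OF sin_paired[of "pi * x"], of "pi * x"] by simp
qed

lemma xi_fps_mult_sinc_fps: "xi_fps * sinc_fps = 1"
proof -
  \<comment> \<open>Both series converge at \<open>x = 1 / 2\<close>, that is at the point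
    \<open>1 / 4\<close> of the variable \<open>x ^ 2\<close>; this bounds the radii of convergence
    from below.\<close>
  have "ereal (norm ((1 / 2 :: real) ^ 2)) \<le> fps_conv_radius xi_fps"
    and "ereal (norm ((1 / 2 :: real) ^ 2)) \<le> fps_conv_radius sinc_fps"
    unfolding fps_conv_radius_def
    by (rule conv_radius_geI, rule sums_summable, rule xi_fps_sums sinc_fps_sums; simp)+
  then have rad: "ereal (1 / 4) \<le> fps_conv_radius xi_fps" "ereal (1 / 4) \<le> fps_conv_radius sinc_fps"
    by (simp_all add: power2_eq_square)
  have rad': "ereal (1 / 4) \<le> fps_conv_radius (xi_fps * sinc_fps)"
    using rad order_trans[OF _ fps_conv_radius_mult] by (metis min.bounded_iff)
  have "xi_fps * sinc_fps - 1 = 0"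
  proof (rule fps_eq_0_if_eval_eq_0_at_right)
    have "ereal (1 / 4) \<le> fps_conv_radius (xi_fps * sinc_fps - 1)"
      using rad' by (intro order_trans[OF _ fps_conv_radius_diff]) auto
    then show "fps_conv_radius (xi_fps * sinc_fps - 1) > 0"
      by (rule less_le_trans[rotated]) simp
    have "eval_fps (xi_fps * sinc_fps - 1) y = 0" if y: "0 < y" "y < 1 / 4" for y
    proof -
      define x where "x = sqrt y"
      have yx: "y = x ^ 2" and "0 < x"
        using y by (simp_all add: x_def)
      have "x < 1"
        using y by (simp add: x_def real_sqrt_lt_1_iff)
      have sin: "sin (pi * x) > 0"
        using \<open>0 < x\<close> \<open>x < 1\<close> by (intro sin_gt_zero) auto
      have "ereal (norm y) < ereal (1 / 4)"
        using y by simp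
      note less = less_le_trans[OF this]
      have "eval_fps (xi_fps * sinc_fps - 1) y = eval_fps xi_fps y * eval_fps sinc_fps y - 1"
        using less[OF rad(1)] less[OF rad(2)] less[OF rad']
        by (subst eval_fps_diff) (auto simp: eval_fps_mult)
      also have "eval_fps xi_fps y = pi * x / sin (pi * x)"
        unfolding eval_fps_def yx using xi_fps_sums[OF \<open>0 < x\<close> \<open>x < 1\<close>] by (simp add: sums_iff)
      also have "eval_fps sinc_fps y = sin (pi * x) / (pi * x)"
        unfolding eval_fps_def yx using sinc_fps_sums[of x] \<open>0 < x\<close> by (simp add: sums_iff)
      finally show ?thesis
        using sin \<open>0 < x\<close> by simp
    qed
    then show "eventually (\<lambda>y. eval_fps (xi_fps * sinc_fps - 1) y = 0) (at_right 0)"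
      by (intro eventually_at_rightI[of 0 "1 / 4"]) auto
  qed
  then show ?thesis
    by simp
qed

section \<open>The recurrence and its rational solution\<close>

text \<open>Polymorphism lets one formula serve both the rational sequence and the real numbers
  \<open>xi (2 * real p) / pi ^ (2 * p)\<close>. At \<open>p = 1\<close> the sum is empty and the
  value is \<open>1 / 12\<close>, so the initial condition needs no separate case.\<close>

definition xi_step :: "nat \<Rightarrow> (nat \<Rightarrow> 'a :: field_char_0) \<Rightarrow> 'a" where
  "xi_step p a = (-1) ^ (p - 1) / fact (2 * p) *
     (1 / (2 * (2 * of_nat p + 1)) -
      (\<Sum>k = 1..p - 1. (-1) ^ (k - 1) * (fact (2 * p) / fact (2 * p + 1 - 2 * k)) * a k))"

text \<open>Only arguments strictly below \<open>p\<close> are consulted. This justifies the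
  termination of \<open>xi_coeff\<close> and drives the strong inductions at the end.\<close>

lemma xi_step_cong [fundef_cong]:
  assumes "p = q" "\<And>k. 1 \<le> k \<Longrightarrow> k < q \<Longrightarrow> a k = b k"
  shows "xi_step p a = xi_step q b"
  unfolding xi_step_def using assms
  by (intro arg_cong2[where f = "(*)"] arg_cong2[where f = "(-)"] sum.cong) auto

text \<open>The coefficient of index \<open>p\<close> in \<open>xi_fps * sinc_fps = 1\<close> is
  zero. Its summand for \<open>k = p\<close> contains the new value, the one for
  \<open>k = 0\<close> is the rational leading term, and the others involve earlier values.\<close>

lemma xi_even_recurrence:
  assumes p: "p \<ge> 1"
  shows "xi (2 * real p) / pi ^ (2 * p) = xi_step p (\<lambda>k. xi (2 * real k) / pi ^ (2 * k))"
proof -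
  let ?a = "\<lambda>k. xi (2 * real k) / pi ^ (2 * k)"
  \<comment> \<open>A middle summand of the convolution after removal of the factor
    \<open>2 * pi ^ (2 * p) * (-1) ^ p\<close>, which is common to all summands.\<close>
  let ?F = "\<lambda>k. (-1) ^ k * ?a k / fact (2 * p + 1 - 2 * k) :: real"
  have split: "{0..p} = insert 0 (insert p {1..p - 1})"
    using p by auto
  have "0 = (\<Sum>k = 0..p. fps_nth xi_fps k * fps_nth sinc_fps (p - k))"
    using p by (simp flip: fps_mult_nth add: xi_fps_mult_sinc_fps)
  also have "\<dots> = fps_nth sinc_fps p +
      (2 * xi (2 * real p) + (\<Sum>k = 1..p - 1. fps_nth xi_fps k * fps_nth sinc_fps (p - k)))"
    unfolding split using p by (simp add: xi_fps_def sinc_fps_def)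
  also have "fps_nth sinc_fps p = (2 * pi ^ (2 * p) * (-1) ^ p) * (1 / (2 * fact (2 * p + 1)))"
    by (simp add: sinc_fps_def)
  also have "2 * xi (2 * real p) = (2 * pi ^ (2 * p) * (-1) ^ p) * ((-1) ^ p * ?a p)"
    by simp
  also have "(\<Sum>k = 1..p - 1. fps_nth xi_fps k * fps_nth sinc_fps (p - k)) =
      (2 * pi ^ (2 * p) * (-1) ^ p) * (\<Sum>k = 1..p - 1. ?F k)"
    unfolding sum_distrib_left
  proof (rule sum.cong[OF refl])
    fix k assume k: "k \<in> {1..p - 1}"
    then have "2 * p = 2 * k + 2 * (p - k)"
      by auto
    then have "pi ^ (2 * p) = pi ^ (2 * k) * pi ^ (2 * (p - k))"
      by (simp only: power_add[symmetric])
    \<comment> \<open>No truncation occurs in these natural-number subtractions, since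
      \<open>k\<close> is less than \<open>p\<close>.\<close>
    moreover have "2 * (p - k) + 1 = 2 * p + 1 - 2 * k"
      using k by auto
    then have "fps_nth sinc_fps (p - k) =
        (-1) ^ (p - k) * pi ^ (2 * (p - k)) / fact (2 * p + 1 - 2 * k)"
      by (simp only: sinc_fps_def fps_nth_Abs_fps)
    moreover have "(-1) ^ (p - k) = ((-1) ^ p * (-1) ^ k :: real)"
      using k by (auto simp: uminus_power_if)
    ultimately show "fps_nth xi_fps k * fps_nth sinc_fps (p - k) =
        2 * pi ^ (2 * p) * (-1) ^ p * ?F k"
      using k by (simp add: xi_fps_def)
  qed
  finally have "(2 * pi ^ (2 * p) * (-1) ^ p) *
      (1 / (2 * fact (2 * p + 1)) + (-1) ^ p * ?a p + (\<Sum>k = 1..p - 1. ?F k)) = 0"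
    by (simp add: distrib_left add.assoc)
  then have "1 / (2 * fact (2 * p + 1)) + (-1) ^ p * ?a p + (\<Sum>k = 1..p - 1. ?F k) = 0"
    by simp
  then have minus: "(-1) ^ p * ?a p = - (1 / (2 * fact (2 * p + 1)) + (\<Sum>k = 1..p - 1. ?F k))"
    by linarith
  have sign: "(-1) ^ p = - ((-1) ^ (p - 1) :: real)"
    using p by (cases p) auto
  \<comment> \<open>The sign squares to one, which isolates the new value; \<open>sign\<close> then
    absorbs the minus into the exponent \<open>p - 1\<close>.\<close>
  have "?a p = (-1) ^ p * ((-1) ^ p * ?a p)"
    by simp
  also have "\<dots> = (-1) ^ (p - 1) * (1 / (2 * fact (2 * p + 1)) + (\<Sum>k = 1..p - 1. ?F k))"
    unfolding minus unfolding sign by (rule minus_mult_minus)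
  also have "(\<Sum>k = 1..p - 1. ?F k) = - (1 / fact (2 * p) *
      (\<Sum>k = 1..p - 1. (-1) ^ (k - 1) * (fact (2 * p) / fact (2 * p + 1 - 2 * k)) * ?a k))"
    unfolding sum_distrib_left sum_negf[symmetric]
    by (rule sum.cong[OF refl]) (auto simp: uminus_power_if)
  also have "1 / (2 * fact (2 * p + 1)) = 1 / fact (2 * p) * (1 / (2 * (2 * real p + 1)))"
    by (simp add: mult_ac)
  finally have "?a p = (-1) ^ (p - 1) * (1 / fact (2 * p) * (1 / (2 * (2 * real p + 1))) + -
      (1 / fact (2 * p) *
        (\<Sum>k = 1..p - 1. (-1) ^ (k - 1) * (fact (2 * p) / fact (2 * p + 1 - 2 * k)) * ?a k)))" .
  moreover have "s * (1 / F * u + - (1 / F * S)) = s / F * (u - S)" for s F u S :: real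
    by (simp add: diff_divide_distrib right_diff_distrib)
  ultimately show ?thesis
    by (simp only: xi_step_def)
qed

lemma xi_step_1: "xi_step (Suc 0) a = 1 / 12"
  by (simp add: xi_step_def fact_numeral)

lemma xi_recurrence_iff: "xi_recurrence A \<longleftrightarrow> (\<forall>p\<ge>1. A p = xi_step p A)"
proof -
  have "1 \<le> p \<longleftrightarrow> p = 1 \<or> 2 \<le> p" for p :: nat
    by auto
  then have "(\<forall>p\<ge>1. A p = xi_step p A) \<longleftrightarrow> A 1 = 1 / 12 \<and> (\<forall>p\<ge>2. A p = xi_step p A)"
    using xi_step_1[of A] by auto
  then show ?thesis
    by (simp only: xi_recurrence_def xi_step_def)
qed

fun xi_coeff :: "nat \<Rightarrow> rat" where
  "xi_coeff p = xi_step p xi_coeff"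

declare xi_coeff.simps [simp del]

lemma of_rat_xi_step:
  "(of_rat (xi_step p a) :: 'a :: field_char_0) = xi_step p (\<lambda>k. of_rat (a k))"
proof -
  have "of_rat (fact n) = (fact n :: 'a)" for n
    by (metis of_nat_fact of_rat_of_nat_eq)
  then show ?thesis
    by (simp add: xi_step_def of_rat_mult of_rat_divide of_rat_diff of_rat_add of_rat_sum
        of_rat_power of_rat_minus)
qed

text \<open>The rational numbers \<open>xi_coeff p\<close>, the quotients
  \<open>xi (2 * real p) / pi ^ (2 * p)\<close> and any competitor \<open>B\<close> all satisfy the
  same step equation for \<open>p \<ge> 1\<close>, so strong induction identifies them. Uniqueness
  starts at index 1 because the recurrence leaves the value at 0 free.\<close>

theorem proposition2:
  "\<exists>A :: nat \<Rightarrow> rat.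
     (\<forall>p\<ge>1. xi (2 * real p) = of_rat (A p) * pi ^ (2 * p)) \<and>
     xi_recurrence A \<and>
     (\<forall>B :: nat \<Rightarrow> rat. xi_recurrence B \<longrightarrow> (\<forall>p\<ge>1. B p = A p))"
proof (intro exI[of _ xi_coeff] conjI allI impI)
  fix p :: nat
  have "xi (2 * real p) / pi ^ (2 * p) = of_rat (xi_coeff p)" if "p \<ge> 1"
    using that
  proof (induction p rule: less_induct)
    case (less p)
    have "xi (2 * real p) / pi ^ (2 * p) = xi_step p (\<lambda>k. xi (2 * real k) / pi ^ (2 * k))"
      by (rule xi_even_recurrence) fact
    also have "\<dots> = xi_step p (\<lambda>k. of_rat (xi_coeff k))"
      using less.IH by (intro xi_step_cong) auto
    also have "\<dots> = of_rat (xi_coeff p)"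
      by (simp add: of_rat_xi_step xi_coeff.simps[of p])
    finally show ?case .
  qed
  then show "xi (2 * real p) = of_rat (xi_coeff p) * pi ^ (2 * p)" if "p \<ge> 1"
    using that by (simp add: field_simps)
next
  show "xi_recurrence xi_coeff"
    using xi_coeff.simps by (simp add: xi_recurrence_iff)
next
  fix B :: "nat \<Rightarrow> rat" and p :: nat
  assume B: "xi_recurrence B" and "p \<ge> 1"
  from \<open>p \<ge> 1\<close> show "B p = xi_coeff p"
  proof (induction p rule: less_induct)
    case (less p)
    have "B p = xi_step p B"
      using B less.prems by (simp add: xi_recurrence_iff)
    also have "\<dots> = xi_step p xi_coeff"
      using less.IH by (intro xi_step_cong) auto
    finally show ?case
      by (simp add: xi_coeff.simps[of p])
  qed
qed

end
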